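(* Let $K$ be an algebraically closed field and let $v$ be a valuation of rank $1$ on $K$, with valuation domain $V$, whose maximal ideal is not finitely generated and whose residue field is infinite. Let $w$ be an extension of $v$ to $K(X)$ of rank $1$, with valuation domain $W$. Then: (a) there is a pseudo-convergent sequence $E=\{s_\nu\}_{\nu\in\Lambda}\subset K$ such that $w(\phi)=\lim_{\nu\to\infty}v(\phi(s_\nu))$ for every nonzero $\phi\in K(X)$; (b) if $V\subset W$ is not immediate, there is also a pseudo-divergent sequence $F=\{t_\nu\}_{\nu\in\Lambda}\subset K$ such that $w(\phi)=\lim_{\nu\to\infty}v(\phi(t_\nu))$ for every nonzero $\phi\in K(X)$.
   Context: Since $v$ and $w$ have rank $1$, both are regarded as real-valued valuations $K\setminus\{0\}\to\mathbb R$ and $K(X)\setminus\{0\}\to\mathbb R$ (not necessarily surjective) with $w|_K=v$; limits are taken in $\mathbb R$ along the index set. The extension $V\subset W$ is immediate if $V$ and $W$ have the same value group and the same residue field. Sequences $\{s_\nu\}_{\nu\in\Lambda}\subset K$ are indexed by well-ordered sets $\Lambda$ without maximum. Such a sequence is pseudo-convergent if $v(s_\rho-s_\nu)<v(s_\sigma-s_\rho)$ for all $\nu<\rho<\sigma$ in $\Lambda$, and pseudo-divergent if $v(s_\rho-s_\nu)>v(s_\sigma-s_\rho)$ for all $\nu<\rho<\sigma$ in $\Lambda$. *)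

theory Defs
  imports Complex_Main "HOL-Computational_Algebra.Computational_Algebra"
begin

section \<open>Real-valued valuations of rank one\<close>

text \<open>A valuation is a map from the nonzero elements of a field to the reals; the value
  of the function at \<open>0\<close> is irrelevant and never used.\<close>

definition valuation :: "('k::field \<Rightarrow> real) \<Rightarrow> bool" where
  "valuation v \<longleftrightarrow>
     (\<forall>x y. x \<noteq> 0 \<longrightarrow> y \<noteq> 0 \<longrightarrow> v (x * y) = v x + v y) \<and>
     (\<forall>x y. x \<noteq> 0 \<longrightarrow> y \<noteq> 0 \<longrightarrow> x + y \<noteq> 0 \<longrightarrow> min (v x) (v y) \<le> v (x + y))"

definition value_group :: "('k::field \<Rightarrow> real) \<Rightarrow> real set" where
  "value_group v = v ` (UNIV - {0})"

definition convex_subgroup :: "real set \<Rightarrow> real set \<Rightarrow> bool" where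
  "convex_subgroup H G \<longleftrightarrow>
     H \<subseteq> G \<and> 0 \<in> H \<and> (\<forall>a\<in>H. \<forall>b\<in>H. a - b \<in> H) \<and>
     (\<forall>a\<in>H. \<forall>b\<in>H. \<forall>g\<in>G. a \<le> g \<longrightarrow> g \<le> b \<longrightarrow> g \<in> H)"

text \<open>The rank of a valuation is the number of proper convex subgroups of its value group.\<close>

definition rank_one_valuation :: "('k::field \<Rightarrow> real) \<Rightarrow> bool" where
  "rank_one_valuation v \<longleftrightarrow>
     valuation v \<and> card {H. convex_subgroup H (value_group v) \<and> H \<noteq> value_group v} = 1"

definition valuation_domain :: "('k::field \<Rightarrow> real) \<Rightarrow> 'k set" where
  "valuation_domain v = {x. x = 0 \<or> 0 \<le> v x}"

definition max_ideal :: "('k::field \<Rightarrow> real) \<Rightarrow> 'k set" where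
  "max_ideal v = {x. x = 0 \<or> 0 < v x}"

definition fin_gen_ideal :: "'k::field set \<Rightarrow> 'k set \<Rightarrow> bool" where
  "fin_gen_ideal R I \<longleftrightarrow>
     (\<exists>G. finite G \<and> G \<subseteq> I \<and> I = {(\<Sum>g\<in>G. c g * g) | c. \<forall>g\<in>G. c g \<in> R})"

definition residue_class :: "('k::field \<Rightarrow> real) \<Rightarrow> 'k \<Rightarrow> 'k set" where
  "residue_class v x = {y \<in> valuation_domain v. y - x \<in> max_ideal v}"

definition residue_field :: "('k::field \<Rightarrow> real) \<Rightarrow> 'k set set" where
  "residue_field v = residue_class v ` valuation_domain v"

section \<open>Rational functions and extensions of a valuation\<close>

text \<open>The field of rational functions \<open>K(X)\<close> is the type \<open>'k poly fract\<close>.\<close>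

definition const_fract :: "'k::field \<Rightarrow> 'k poly fract" where
  "const_fract a = to_fract [:a:]"

text \<open>The value of a rational function at a point where it is defined; unspecified at a pole.\<close>

definition fract_eval :: "'k::field poly fract \<Rightarrow> 'k \<Rightarrow> 'k" where
  "fract_eval \<phi> x =
     (THE y. \<exists>p q. \<phi> = Fract p q \<and> poly q x \<noteq> 0 \<and> y = poly p x / poly q x)"

definition extends_valuation :: "('k::field poly fract \<Rightarrow> real) \<Rightarrow> ('k \<Rightarrow> real) \<Rightarrow> bool" where
  "extends_valuation w v \<longleftrightarrow> (\<forall>a. a \<noteq> 0 \<longrightarrow> w (const_fract a) = v a)"

text \<open>The second conjunct says that the canonical embedding of residue fields, sending the
  class of \<open>a\<close> for \<open>v\<close> to its class for \<open>w\<close>, is onto.\<close>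

definition immediate_extension :: "('k::field poly fract \<Rightarrow> real) \<Rightarrow> ('k \<Rightarrow> real) \<Rightarrow> bool" where
  "immediate_extension w v \<longleftrightarrow>
     value_group w = value_group v \<and>
     residue_field w = (\<lambda>a. residue_class w (const_fract a)) ` valuation_domain v"

section \<open>Pseudo-monotone sequences\<close>

text \<open>An index set is given by a reflexive well-order relation \<open>r\<close> on its carrier
  \<open>Field r\<close>; \<open>(i, j) \<in> r\<close> means \<open>i \<le> j\<close>.\<close>

definition index_order :: "'i rel \<Rightarrow> bool" where
  "index_order r \<longleftrightarrow>
     Well_order r \<and> Field r \<noteq> {} \<and> (\<forall>i\<in>Field r. \<exists>j. (i, j) \<in> r \<and> i \<noteq> j)"

definition index_less :: "'i rel \<Rightarrow> 'i \<Rightarrow> 'i \<Rightarrow> bool" where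
  "index_less r i j \<longleftrightarrow> (i, j) \<in> r \<and> i \<noteq> j"

definition index_filter :: "'i rel \<Rightarrow> 'i filter" where
  "index_filter r = (INF i\<in>Field r. principal {j. (i, j) \<in> r})"

text \<open>Since a valuation is defined on nonzero elements only, the inequalities below presuppose
  that the terms of the sequence are distinct. Consequently a sequence meets the zeros and
  poles of a given nonzero rational function at most finitely often, so in a limit of
  \<open>v (fract_eval \<phi> (s i))\<close> along the index set all but finitely many terms are meaningful.
  Moreover every index set of such a sequence in \<open>K\<close> is order isomorphic to one
  whose carrier is a subset of \<open>K\<close>.\<close>

definition pseudo_convergent :: "('k::field \<Rightarrow> real) \<Rightarrow> 'i rel \<Rightarrow> ('i \<Rightarrow> 'k) \<Rightarrow> bool" where
  "pseudo_convergent v r s \<longleftrightarrow>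
     inj_on s (Field r) \<and>
     (\<forall>i j k. index_less r i j \<longrightarrow> index_less r j k \<longrightarrow> v (s j - s i) < v (s k - s j))"

definition pseudo_divergent :: "('k::field \<Rightarrow> real) \<Rightarrow> 'i rel \<Rightarrow> ('i \<Rightarrow> 'k) \<Rightarrow> bool" where
  "pseudo_divergent v r s \<longleftrightarrow>
     inj_on s (Field r) \<and>
     (\<forall>i j k. index_less r i j \<longrightarrow> index_less r j k \<longrightarrow> v (s j - s i) > v (s k - s j))"

definition limit_valuation ::
    "('k::field poly fract \<Rightarrow> real) \<Rightarrow> ('k \<Rightarrow> real) \<Rightarrow> 'i rel \<Rightarrow> ('i \<Rightarrow> 'k) \<Rightarrow> bool" where
  "limit_valuation w v r s \<longleftrightarrow>
     (\<forall>\<phi>. \<phi> \<noteq> 0 \<longrightarrow> ((\<lambda>i. v (fract_eval \<phi> (s i))) \<longlongrightarrow> w \<phi>) (index_filter r))"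

end

(* Over an algebraically closed field every rational function is a constant times a quotient of
   products of linear polynomials, so a sequence s defines w as soon as v (s n - a) tends to
   g a = w (X - a) for every a.

   If g has no maximum, choose s with g (s n) strictly increasing and cofinal in the range of g.
   Then v (s n - a) = g a for all large n. Moreover (X - a) / (s n - a) = 1 + (X - s n) / (s n - a)
   is then a one-unit of W; hence every nonzero rational function is a constant times a one-unit,
   so W is immediate over V.

   If g attains its maximum m at b, then g a = min m (v (a - b)) for a other than b. The value
   group is divisible and nontrivial, hence dense in the reals, so there are c n with v (c n)
   tending to m strictly monotonically, from either side, and s n = b + c n works. *)

theory Submission
  imports Defs
begin

section \<open>Valuations\<close>

lemma valuation_mult:
  "valuation v \<Longrightarrow> x \<noteq> 0 \<Longrightarrow> y \<noteq> 0 \<Longrightarrow> v (x * y) = v x + v y"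
  by (simp add: valuation_def)

lemma valuation_add:
  "valuation v \<Longrightarrow> x \<noteq> 0 \<Longrightarrow> y \<noteq> 0 \<Longrightarrow> x + y \<noteq> 0 \<Longrightarrow> min (v x) (v y) \<le> v (x + y)"
  by (simp add: valuation_def)

lemma valuation_one: "valuation v \<Longrightarrow> v 1 = 0"
  using valuation_mult[of v 1 1] by simp

lemma valuation_minus:
  assumes "valuation v" shows "v (- x) = v x"
proof (cases "x = 0")
  case False
  have "2 * v (- 1) = 0"
    using valuation_mult[OF assms, of "- 1" "- 1"] valuation_one[OF assms] by simp
  then show ?thesis
    using valuation_mult[OF assms, of "- 1" x] False by simp
qed simp

lemma valuation_minus_commute: "valuation v \<Longrightarrow> v (x - y) = v (y - x)"
  using valuation_minus[of v "x - y"] by simp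

lemma valuation_inverse:
  "valuation v \<Longrightarrow> x \<noteq> 0 \<Longrightarrow> v (inverse x) = - v x"
  using valuation_mult[of v x "inverse x"] valuation_one[of v] by simp

lemma valuation_divide:
  "valuation v \<Longrightarrow> x \<noteq> 0 \<Longrightarrow> y \<noteq> 0 \<Longrightarrow> v (x / y) = v x - v y"
  by (simp add: divide_inverse valuation_mult valuation_inverse)

lemma valuation_power:
  "valuation v \<Longrightarrow> x \<noteq> 0 \<Longrightarrow> v (x ^ n) = real n * v x"
  by (induction n) (auto simp: valuation_one valuation_mult algebra_simps)

lemma valuation_power_int:
  "valuation v \<Longrightarrow> x \<noteq> 0 \<Longrightarrow> v (x powi k) = of_int k * v x"
  by (simp add: power_int_def valuation_power valuation_inverse)

text \<open>The upper bound for \<open>v (x + y)\<close> comes from writing \<open>x\<close> as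
  \<open>(x + y) + (- y)\<close>. The sum cannot vanish, since \<open>x\<close> and
  \<open>- x\<close> have the same value.\<close>

lemma valuation_add_dominant:
  assumes "valuation v" "x \<noteq> 0" "y \<noteq> 0" "v x < v y"
  shows "x + y \<noteq> 0" "v (x + y) = v x"
proof -
  show nz: "x + y \<noteq> 0"
  proof
    assume "x + y = 0"
    then have "y = - x" by (simp add: eq_neg_iff_add_eq_0 add.commute)
    with assms show False by (simp add: valuation_minus)
  qed
  have "min (v x) (v y) \<le> v (x + y)" using assms nz by (intro valuation_add)
  moreover have "min (v (x + y)) (v (- y)) \<le> v x"
    using valuation_add[of v "x + y" "- y"] assms nz by simp
  ultimately show "v (x + y) = v x"
    using assms by (simp add: valuation_minus min_def split: if_splits)
qed

lemma valuation_diff_eq_min: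
  assumes "valuation v" "x \<noteq> 0" "y \<noteq> 0" "v x \<noteq> v y"
  shows "v (x - y) = min (v x) (v y)"
proof (cases "v x < v y")
  case True
  then show ?thesis
    using valuation_add_dominant(2)[of v x "- y"] assms by (simp add: valuation_minus)
next
  case False
  then show ?thesis
    using valuation_add_dominant(2)[of v "- y" x] assms by (simp add: valuation_minus)
qed

section \<open>The maximal ideal, one-units and residue classes\<close>

lemma max_ideal_add:
  assumes "valuation v" "x \<in> max_ideal v" "y \<in> max_ideal v"
  shows "x + y \<in> max_ideal v"
proof (cases "x = 0 \<or> y = 0 \<or> x + y = 0")
  case False
  then show ?thesis
    using valuation_add[of v x y] assms by (auto simp: max_ideal_def min_def split: if_splits)
qed (use assms in \<open>auto simp: max_ideal_def\<close>)

lemma max_ideal_mult: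
  assumes "valuation v" "x \<in> valuation_domain v" "y \<in> max_ideal v"
  shows "x * y \<in> max_ideal v"
  using assms valuation_mult[of v x y]
  by (cases "x = 0 \<or> y = 0") (auto simp: max_ideal_def valuation_domain_def)

lemma max_ideal_minus:
  "valuation v \<Longrightarrow> x \<in> max_ideal v \<Longrightarrow> - x \<in> max_ideal v"
  by (auto simp: max_ideal_def valuation_minus)

lemma max_ideal_subset: "max_ideal v \<subseteq> valuation_domain v"
  by (auto simp: max_ideal_def valuation_domain_def)

lemma one_unit:
  assumes "valuation v" "u \<in> max_ideal v"
  shows "1 + u \<noteq> 0" "v (1 + u) = 0"
  using valuation_add_dominant[of v 1 u] assms
  by (cases "u = 0"; simp add: max_ideal_def valuation_one)+

lemma residue_class_cong:
  assumes "valuation v" "x - y \<in> max_ideal v"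
  shows "residue_class v x = residue_class v y"
proof -
  have "z - x \<in> max_ideal v \<longleftrightarrow> z - y \<in> max_ideal v" for z
    using max_ideal_add[OF assms(1), of "z - x" "x - y"]
      max_ideal_add[OF assms(1), of "z - y" "y - x"] max_ideal_minus[OF assms] assms(2)
    by auto
  then show ?thesis by (auto simp: residue_class_def)
qed

section \<open>Density of the value group\<close>

text \<open>The group \<open>{0}\<close> has no proper convex subgroup, so a trivial valuation has
  rank 0.\<close>

lemma rank_one_nontrivial:
  assumes "rank_one_valuation v"
  shows "\<exists>x. x \<noteq> 0 \<and> v x \<noteq> 0"
proof (rule ccontr)
  assume "\<not> ?thesis"
  then have "value_group v = {0}"
    using valuation_one[of v] assms
    unfolding value_group_def rank_one_valuation_def by (auto intro!: image_eqI[of _ _ 1])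
  then have "{H. convex_subgroup H (value_group v) \<and> H \<noteq> value_group v} = {}"
    by (auto simp: convex_subgroup_def)
  with assms show False by (simp add: rank_one_valuation_def)
qed

text \<open>Roots in an algebraically closed field make the value group divisible: an n-th root of
  an element of positive value has arbitrarily small positive value, and some integer power of it
  lands in the interval.\<close>

lemma value_group_dense:
  fixes v :: "'k::alg_closed_field \<Rightarrow> real"
  assumes "rank_one_valuation v" "a < b"
  shows "\<exists>c. c \<noteq> 0 \<and> a < v c \<and> v c < b"
proof -
  have val: "valuation v" using assms(1) by (simp add: rank_one_valuation_def)
  obtain x where x: "x \<noteq> 0" "v x > 0"
  proof -
    obtain x where "x \<noteq> 0" "v x \<noteq> 0" using rank_one_nontrivial[OF assms(1)] by blast
    then show thesis
      using that[of x] that[of "inverse x"] valuation_inverse[OF val, of x] by fastforce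
  qed
  obtain n :: nat where n: "v x / (b - a) < real n" using reals_Archimedean2 by blast
  moreover have "0 < v x / (b - a)" using x assms(2) by simp
  ultimately have n0: "0 < n" using less_trans of_nat_0_less_iff by blast
  obtain y where y: "y ^ n = x" using nth_root_exists[OF n0] by blast
  have y0: "y \<noteq> 0" using y x n0 by auto
  have "real n * v y = v x" using valuation_power[OF val y0, of n] y by simp
  then have vy: "v y = v x / real n" using n0 by (simp add: field_simps)
  then have pos: "v y > 0" using x n0 by simp
  have small: "v y < b - a" using n n0 assms(2) unfolding vy by (simp add: field_simps)
  \<comment> \<open>This is the least integer with \<open>a < k * v y\<close>; the overshoot is at
    most \<open>v y\<close>, which is less than \<open>b - a\<close>.\<close>
  define k where "k = \<lfloor>a / v y\<rfloor> + 1"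
  have "a / v y < of_int k" "of_int k \<le> a / v y + 1" unfolding k_def by linarith+
  then have "a < of_int k * v y" "of_int k * v y \<le> a + v y"
    using pos by (simp_all add: field_simps)
  then show ?thesis
    using small y0 by (intro exI[of _ "y powi k"]) (simp add: valuation_power_int[OF val])
qed

section \<open>Rational functions\<close>

text \<open>Splitting into linear factors reduces a multiplicative statement to constants and to X -
  a; the proof is an induction over the multiset of roots.\<close>

lemma poly_linear_factors_induct [consumes 1, case_names const linear]:
  fixes p :: "'k::alg_closed_field poly"
  assumes "p \<noteq> 0"
    and const: "\<And>c. c \<noteq> 0 \<Longrightarrow> P [:c:]"
    and linear: "\<And>a p. p \<noteq> 0 \<Longrightarrow> P p \<Longrightarrow> P ([:- a, 1:] * p)"
  shows "P p"
proof -
  obtain A where A: "p = smult (lead_coeff p) (\<Prod>x\<in>#A. [:- x, 1:])"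
    using alg_closed_imp_factorization[OF assms(1)] by blast
  \<comment> \<open>Nonvanishing is carried along because \<open>linear\<close> asks for it.\<close>
  have "smult c (\<Prod>x\<in>#A. [:- x, 1:]) \<noteq> 0 \<and> P (smult c (\<Prod>x\<in>#A. [:- x, 1:]))"
    if "c \<noteq> 0" for c
    using that
  proof (induction A)
    case empty
    then show ?case using const by simp
  next
    case (add x A)
    then show ?case
      using linear[of "smult c (\<Prod>x\<in>#A. [:- x, 1:])" x] by (simp del: mult_pCons_left)
  qed
  then show ?thesis using A assms(1) by (metis leading_coeff_0_iff)
qed

text \<open>Evaluating the cross-multiplied identity at \<open>x\<close> shows that any two
  representations without a pole at \<open>x\<close> give the same value.\<close>

lemma fract_eval_Fract:
  fixes p q :: "'k::field poly"
  assumes "poly q x \<noteq> 0"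
  shows "fract_eval (Fract p q) x = poly p x / poly q x"
  unfolding fract_eval_def
proof (rule the_equality)
  fix y
  assume "\<exists>p' q'. Fract p q = Fract p' q' \<and> poly q' x \<noteq> 0 \<and> y = poly p' x / poly q' x"
  then obtain p' q' where *: "Fract p q = Fract p' q'" "poly q' x \<noteq> 0" "y = poly p' x / poly q' x"
    by blast
  have "q \<noteq> 0" "q' \<noteq> 0" using assms * by auto
  then have "p * q' = p' * q" using * by (simp add: eq_fract)
  then have "poly p x * poly q' x = poly p' x * poly q x" by (metis poly_mult)
  then show "y = poly p x / poly q x" using assms * by (simp add: frac_eq_eq)
qed (use assms in blast)

lemma const_fract_0 [simp]: "const_fract 0 = 0"
  and const_fract_1 [simp]: "const_fract 1 = 1"
  and const_fract_eq_0_iff [simp]: "const_fract a = 0 \<longleftrightarrow> a = 0"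
  by (simp_all add: const_fract_def flip: one_pCons)

lemma const_fract_mult: "const_fract (a * b) = const_fract a * const_fract b"
  by (simp add: const_fract_def flip: to_fract_mult)

lemma const_fract_inverse: "const_fract (inverse a) = inverse (const_fract a)"
proof (cases "a = 0")
  case False
  then have "const_fract a * const_fract (inverse a) = 1"
    by (simp flip: const_fract_mult)
  then show ?thesis by (metis inverse_unique)
qed simp

text \<open>This is X - a as an element of K(X). The values of \<open>w\<close> on these elements,
  together with \<open>v\<close>, determine \<open>w\<close>.\<close>

abbreviation lin :: "'k::field \<Rightarrow> 'k poly fract" where
  "lin a \<equiv> to_fract [:- a, 1:]"

lemma lin_diff: "lin a - lin b = const_fract (b - a)"
  by (simp add: const_fract_def flip: to_fract_diff)

lemma extends_valuation_const: "extends_valuation w v \<Longrightarrow> a \<noteq> 0 \<Longrightarrow> w (const_fract a) = v a"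
  by (simp add: extends_valuation_def)

text \<open>The difference of the two linear functions is the constant \<open>b - a\<close>, so its
  value is the smaller of two distinct values.\<close>

lemma valuation_lin_dominant:
  assumes "valuation w" "extends_valuation w v" "w (lin a) < w (lin b)"
  shows "v (b - a) = w (lin a)"
proof -
  have "w (const_fract (b - a)) = w (lin a)"
    using valuation_diff_eq_min[of w "lin a" "lin b"] assms by (simp add: lin_diff)
  moreover have "b \<noteq> a" using assms(3) by auto
  ultimately show ?thesis using extends_valuation_const[OF assms(2), of "b - a"] by simp
qed

lemma valuation_lin_at_max:
  assumes v: "valuation v" and w: "valuation w" "extends_valuation w v"
    and max: "\<And>a. w (lin a) \<le> w (lin b)" and "a \<noteq> b"
  shows "w (lin a) = min (w (lin b)) (v (a - b))"
proof (cases "w (lin a) < w (lin b)")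
  case True
  with valuation_lin_dominant[OF w True] show ?thesis
    by (simp add: valuation_minus_commute[OF v])
next
  case False
  with max[of a] have eq: "w (lin a) = w (lin b)" by simp
  \<comment> \<open>With both values equal to the maximum, the ultrametric inequality gives
    \<open>w (lin b) \<le> v (a - b)\<close>, so the minimum is \<open>w (lin b)\<close>.\<close>
  have "lin b + - lin a = const_fract (a - b)" by (simp add: lin_diff)
  then have "min (w (lin b)) (w (- lin a)) \<le> w (const_fract (a - b))"
    using valuation_add[OF w(1), of "lin b" "- lin a"] \<open>a \<noteq> b\<close> by simp
  then show ?thesis
    using eq \<open>a \<noteq> b\<close> extends_valuation_const[OF w(2), of "a - b"]
    by (simp add: valuation_minus[OF w(1)])
qed

section \<open>Sequences of points defining the extension\<close>

text \<open>Values of linear factors add up. Eventual nonvanishing belongs to the induction because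
  \<open>v\<close> is additive on products of nonzero elements only.\<close>

lemma tendsto_valuation_poly:
  fixes v :: "'k::alg_closed_field \<Rightarrow> real"
  assumes v: "valuation v" and w: "valuation w" "extends_valuation w v"
    and inj: "inj s" and lim: "\<And>a. (\<lambda>n. v (s n - a)) \<longlonglongrightarrow> w (lin a)"
    and "p \<noteq> 0"
  shows "(\<forall>\<^sub>F n in sequentially. poly p (s n) \<noteq> 0) \<and>
    (\<lambda>n. v (poly p (s n))) \<longlonglongrightarrow> w (to_fract p)"
  using \<open>p \<noteq> 0\<close>
proof (induction p rule: poly_linear_factors_induct)
  case (const c)
  then show ?case using extends_valuation_const[OF w(2), of c] by (simp add: const_fract_def)
next
  case (linear a p)
  \<comment> \<open>An injective sequence takes the value \<open>a\<close> at most once.\<close>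
  have "\<forall>\<^sub>F n in sequentially. s n \<noteq> a"
    unfolding cofinite_eq_sequentially[symmetric] eventually_cofinite
    using finite_vimageI[OF _ inj, of "{a}"] by (simp add: vimage_def)
  then have nz: "\<forall>\<^sub>F n in sequentially. s n - a \<noteq> 0 \<and> poly p (s n) \<noteq> 0"
    using linear.IH by (auto elim: eventually_elim2)
  have "(\<lambda>n. v (s n - a) + v (poly p (s n))) \<longlonglongrightarrow> w (lin a) + w (to_fract p)"
    using linear.IH lim by (intro tendsto_add) auto
  also have "w (lin a) + w (to_fract p) = w (to_fract ([:- a, 1:] * p))"
    using linear.hyps valuation_mult[OF w(1), of "lin a" "to_fract p"]
    by (simp del: mult_pCons_left add: to_fract_mult)
  finally have "(\<lambda>n. v (poly ([:- a, 1:] * p) (s n))) \<longlonglongrightarrow> w (to_fract ([:- a, 1:] * p))"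
    by (rule Lim_transform_eventually)
      (use nz in eventually_elim, simp add: valuation_mult[OF v, symmetric] algebra_simps)
  moreover have "\<forall>\<^sub>F n in sequentially. poly ([:- a, 1:] * p) (s n) \<noteq> 0"
    using nz by eventually_elim (simp add: algebra_simps flip: right_diff_distrib)
  ultimately show ?case by blast
qed

text \<open>Numerator and denominator are eventually nonzero along \<open>s\<close>, so the limits
  of their values may be subtracted.\<close>

lemma tendsto_valuation_fract_eval:
  fixes v :: "'k::alg_closed_field \<Rightarrow> real"
  assumes "valuation v" "valuation w" "extends_valuation w v"
    and "inj s" "\<And>a. (\<lambda>n. v (s n - a)) \<longlonglongrightarrow> w (lin a)" "\<phi> \<noteq> 0"
  shows "(\<lambda>n. v (fract_eval \<phi> (s n))) \<longlonglongrightarrow> w \<phi>"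
proof (cases \<phi>)
  case (Fract p q)
  then have nz: "p \<noteq> 0" "q \<noteq> 0" using assms(6) by (auto simp: fract_collapse)
  note P = tendsto_valuation_poly[OF assms(1-5) nz(1)]
  note Q = tendsto_valuation_poly[OF assms(1-5) nz(2)]
  have "w \<phi> = w (to_fract p) - w (to_fract q)"
    using valuation_divide[OF assms(2), of "to_fract p" "to_fract q"] nz Fract
    by (simp add: Fract_conv_to_fract)
  moreover have "(\<lambda>n. v (poly p (s n)) - v (poly q (s n))) \<longlonglongrightarrow> w (to_fract p) - w (to_fract q)"
    using P Q by (intro tendsto_diff) auto
  moreover have "\<forall>\<^sub>F n in sequentially.
      v (poly p (s n)) - v (poly q (s n)) = v (fract_eval \<phi> (s n))"
    using P[THEN conjunct1] Q[THEN conjunct1]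
    by eventually_elim (simp add: Fract fract_eval_Fract valuation_divide[OF assms(1)])
  ultimately show ?thesis by (simp add: Lim_transform_eventually)
qed

text \<open>The index set must be carried by the field itself, so an injective sequence is indexed by
  its own terms.\<close>

definition seq_order :: "(nat \<Rightarrow> 'k) \<Rightarrow> 'k rel" where
  "seq_order s = dir_image natLeq s"

lemma mem_seq_order: "(x, y) \<in> seq_order s \<longleftrightarrow> (\<exists>i j. x = s i \<and> y = s j \<and> i \<le> j)"
  by (auto simp: seq_order_def dir_image_def natLeq_def)

lemma Field_seq_order: "Field (seq_order s) = range s"
  by (simp add: seq_order_def dir_image_Field Field_natLeq)

lemma index_order_seq_order:
  assumes "inj s" shows "index_order (seq_order s)"
proof -
  have "Well_order (seq_order s)"
    unfolding seq_order_def
    using assms by (intro Well_order_dir_image natLeq_Well_order) (simp add: Field_natLeq)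
  moreover have "(s i, s (Suc i)) \<in> seq_order s \<and> s i \<noteq> s (Suc i)" for i
    using assms by (auto simp: mem_seq_order inj_eq)
  ultimately show ?thesis
    unfolding index_order_def by (auto simp: Field_seq_order)
qed

lemma index_less_seq_order:
  "inj s \<Longrightarrow> index_less (seq_order s) x y \<longleftrightarrow> (\<exists>i j. x = s i \<and> y = s j \<and> i < j)"
  unfolding index_less_def mem_seq_order by (metis inj_eq le_neq_implies_less less_imp_le less_irrefl)

text \<open>The terms above \<open>s N\<close> are exactly the \<open>s n\<close> with
  \<open>n \<ge> N\<close>. This inequality carries limits along natural numbers over to the index
  set.\<close>

lemma index_filter_seq_order:
  assumes "inj s" shows "index_filter (seq_order s) \<le> filtermap s sequentially"
proof (rule filter_leI)
  fix P assume "eventually P (filtermap s sequentially)"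
  then obtain N where N: "\<And>n. n \<ge> N \<Longrightarrow> P (s n)"
    by (auto simp: eventually_filtermap eventually_sequentially)
  have "index_filter (seq_order s) \<le> principal {y. (s N, y) \<in> seq_order s}"
    unfolding index_filter_def by (rule INF_lower) (simp add: Field_seq_order)
  moreover have "eventually P (principal {y. (s N, y) \<in> seq_order s})"
    using assms N by (auto simp: eventually_principal mem_seq_order inj_eq)
  ultimately show "eventually P (index_filter (seq_order s))"
    by (simp add: le_filter_def)
qed

lemma limit_valuation_seq_order:
  fixes v :: "'k::alg_closed_field \<Rightarrow> real"
  assumes "valuation v" "valuation w" "extends_valuation w v"
    and "inj s" "\<And>a. (\<lambda>n. v (s n - a)) \<longlonglongrightarrow> w (lin a)"
  shows "limit_valuation w v (seq_order s) (\<lambda>x. x)"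
  unfolding limit_valuation_def
proof (intro allI impI)
  fix \<phi> :: "'k poly fract" assume "\<phi> \<noteq> 0"
  then have "((\<lambda>x. v (fract_eval \<phi> x)) \<longlongrightarrow> w \<phi>) (filtermap s sequentially)"
    using tendsto_valuation_fract_eval[OF assms] by (simp add: filterlim_filtermap)
  then show "((\<lambda>x. v (fract_eval \<phi> x)) \<longlongrightarrow> w \<phi>) (index_filter (seq_order s))"
    using index_filter_seq_order[OF assms(4)] by (rule tendsto_mono[rotated])
qed

text \<open>The value of a difference depends on its earlier index alone, so the required inequality
  becomes \<open>d i < d j\<close>.\<close>

lemma pseudo_convergent_seq_order:
  assumes "inj s" "\<And>i j. i < j \<Longrightarrow> v (s j - s i) = d i" "strict_mono d"
  shows "pseudo_convergent v (seq_order s) (\<lambda>x. x)"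
  using assms unfolding pseudo_convergent_def
  by (auto simp: index_less_seq_order inj_eq strict_mono_def)

text \<open>Here the later index decides, and the inequality becomes \<open>d k < d j\<close> for
  \<open>j < k\<close>.\<close>

lemma pseudo_divergent_seq_order:
  assumes "inj s" "\<And>i j. i < j \<Longrightarrow> v (s j - s i) = d j" "\<And>i j. i < j \<Longrightarrow> d j < d i"
  shows "pseudo_divergent v (seq_order s) (\<lambda>x. x)"
  using assms unfolding pseudo_divergent_def
  by (auto simp: index_less_seq_order inj_eq)

section \<open>The maximum is attained\<close>

text \<open>As soon as \<open>v (c n)\<close> and \<open>v (a - b)\<close> differ,
  \<open>v (b + c n - a)\<close> is their minimum, whose limit is the value of \<open>lin a\<close>
  found in \<open>valuation_lin_at_max\<close>.\<close>

lemma tendsto_valuation_around_center: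
  assumes v: "valuation v" and w: "valuation w" "extends_valuation w v"
    and max: "\<And>a. w (lin a) \<le> w (lin b)"
    and c: "\<And>n. c n \<noteq> 0" "\<And>n. v (c n) \<noteq> w (lin b)" "(\<lambda>n. v (c n)) \<longlonglongrightarrow> w (lin b)"
  shows "(\<lambda>n. v (b + c n - a)) \<longlonglongrightarrow> w (lin a)"
proof (cases "a = b")
  case False
  \<comment> \<open>If \<open>v (a - b)\<close> is the limit, the terms avoid it by assumption;
    otherwise convergence keeps them away from it eventually.\<close>
  have "\<forall>\<^sub>F n in sequentially. v (c n) \<noteq> v (a - b)"
    using c tendsto_imp_eventually_ne[OF c(3), of "v (a - b)"]
    by (cases "v (a - b) = w (lin b)") auto
  then have "\<forall>\<^sub>F n in sequentially. min (v (c n)) (v (a - b)) = v (b + c n - a)"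
  proof eventually_elim
    case (elim n)
    then have "v (c n - (a - b)) = min (v (c n)) (v (a - b))"
      using v c(1) False by (intro valuation_diff_eq_min) auto
    then show ?case by (simp add: algebra_simps)
  qed
  moreover have "(\<lambda>n. min (v (c n)) (v (a - b))) \<longlonglongrightarrow> min (w (lin b)) (v (a - b))"
    using c(3) by (intro tendsto_min tendsto_const)
  ultimately show ?thesis
    using valuation_lin_at_max[OF v w max False] by (simp add: Lim_transform_eventually)
qed (use c in simp)

lemma pseudo_convergent_around_center:
  fixes v :: "'k::alg_closed_field \<Rightarrow> real"
  assumes rank: "rank_one_valuation v" and w: "valuation w" "extends_valuation w v"
    and max: "\<And>a. w (lin a) \<le> w (lin b)"
  shows "\<exists>s. inj s \<and> pseudo_convergent v (seq_order s) (\<lambda>x. x) \<and>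
    limit_valuation w v (seq_order s) (\<lambda>x. x)"
proof -
  have v: "valuation v" using rank by (simp add: rank_one_valuation_def)
  define m where "m = w (lin b)"
  \<comment> \<open>Consecutive open intervals share only an endpoint, which forces strict growth,
    and they shrink towards \<open>m\<close>.\<close>
  have "\<exists>c. c \<noteq> 0 \<and> m - 1 / real (Suc n) < v c \<and> v c < m - 1 / real (Suc (Suc n))" for n
    using rank by (intro value_group_dense) (simp_all add: field_simps)
  then obtain c where c: "\<And>n. c n \<noteq> 0" "\<And>n. m - 1 / real (Suc n) < v (c n)"
      "\<And>n. v (c n) < m - 1 / real (Suc (Suc n))"
    by metis
  have mono: "strict_mono (\<lambda>n. v (c n))"
    using less_trans[OF c(3) c(2)] unfolding strict_mono_Suc_iff by blast
  have below: "v (c n) < m" for n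
    using c(3)[of n] by (rule order_less_trans) simp
  have lim: "(\<lambda>n. v (c n)) \<longlonglongrightarrow> m"
  proof (rule tendsto_sandwich)
    show "(\<lambda>n. m - 1 / real (Suc n)) \<longlonglongrightarrow> m"
      using tendsto_diff[OF tendsto_const[of m] lim_inverse_n'[THEN LIMSEQ_Suc]] by simp
  qed (use c(2) below in \<open>auto intro!: always_eventually less_imp_le\<close>)
  define s where "s n = b + c n" for n
  have inj: "inj s"
    using strict_mono_eq[OF mono] by (intro injI) (metis add_left_cancel s_def)
  \<comment> \<open>The center cancels, and \<open>c i\<close> has the smaller value.\<close>
  have "v (s j - s i) = v (c i)" if "i < j" for i j
    using valuation_diff_eq_min[OF v c(1) c(1), of j i] strict_monoD[OF mono that]
    by (simp add: s_def)
  then have "pseudo_convergent v (seq_order s) (\<lambda>x. x)"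
    using inj mono by (intro pseudo_convergent_seq_order)
  moreover have "(\<lambda>n. v (s n - a)) \<longlonglongrightarrow> w (lin a)" for a
    unfolding s_def using below[unfolded m_def]
    by (intro tendsto_valuation_around_center[OF v w max c(1) _ lim[unfolded m_def]])
      (simp add: less_imp_neq)
  ultimately show ?thesis
    using limit_valuation_seq_order[OF v w inj] inj by blast
qed

lemma pseudo_divergent_around_center:
  fixes v :: "'k::alg_closed_field \<Rightarrow> real"
  assumes rank: "rank_one_valuation v" and w: "valuation w" "extends_valuation w v"
    and max: "\<And>a. w (lin a) \<le> w (lin b)"
  shows "\<exists>s. inj s \<and> pseudo_divergent v (seq_order s) (\<lambda>x. x) \<and>
    limit_valuation w v (seq_order s) (\<lambda>x. x)"
proof -
  have v: "valuation v" using rank by (simp add: rank_one_valuation_def)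
  define m where "m = w (lin b)"
  \<comment> \<open>The same intervals reflected in \<open>m\<close>: the values now decrease to
    \<open>m\<close> from above.\<close>
  have "\<exists>c. c \<noteq> 0 \<and> m + 1 / real (Suc (Suc n)) < v c \<and> v c < m + 1 / real (Suc n)" for n
    using rank by (intro value_group_dense) (simp_all add: field_simps)
  then obtain c where c: "\<And>n. c n \<noteq> 0" "\<And>n. m + 1 / real (Suc (Suc n)) < v (c n)"
      "\<And>n. v (c n) < m + 1 / real (Suc n)"
    by metis
  have "strict_mono (\<lambda>n. - v (c n))"
    using less_trans[OF c(3) c(2)] unfolding strict_mono_Suc_iff by simp
  then have anti: "v (c j) < v (c i)" if "i < j" for i j
    using that by (simp add: strict_mono_def)
  have above: "m < v (c n)" for n
    using c(2)[of n] by (rule order_less_trans[rotated]) simp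
  have lim: "(\<lambda>n. v (c n)) \<longlonglongrightarrow> m"
  proof (rule tendsto_sandwich[OF _ _ tendsto_const])
    show "(\<lambda>n. m + 1 / real (Suc n)) \<longlonglongrightarrow> m"
      using tendsto_add[OF tendsto_const[of m] lim_inverse_n'[THEN LIMSEQ_Suc]] by simp
  qed (use c(3) above in \<open>auto intro!: always_eventually less_imp_le\<close>)
  define s where "s n = b + c n" for n
  have inj: "inj s"
  proof (rule linorder_injI)
    show "s i \<noteq> s j" if "i < j" for i j using anti[OF that] by (auto simp: s_def)
  qed
  \<comment> \<open>Values decrease, so the later term dominates the difference.\<close>
  have "v (s j - s i) = v (c j)" if "i < j" for i j
    using valuation_diff_eq_min[OF v c(1) c(1), of j i] anti[OF that]
    by (simp add: s_def)
  then have "pseudo_divergent v (seq_order s) (\<lambda>x. x)"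
    using anti by (intro pseudo_divergent_seq_order[OF inj])
  moreover have "(\<lambda>n. v (s n - a)) \<longlonglongrightarrow> w (lin a)" for a
    unfolding s_def using above[unfolded m_def]
    by (intro tendsto_valuation_around_center[OF v w max c(1) _ lim[unfolded m_def]])
      (metis less_irrefl)
  ultimately show ?thesis
    using limit_valuation_seq_order[OF v w inj] inj by blast
qed

section \<open>The maximum is not attained\<close>

text \<open>A countable cofinal set of thresholds exists because the values are real; points are
  then chosen recursively above the thresholds and above each other.\<close>

lemma cofinal_sequence:
  fixes g :: "'a \<Rightarrow> real"
  assumes no_max: "\<And>a. \<exists>b. g a < g b"
  shows "\<exists>s. strict_mono (\<lambda>n. g (s n)) \<and> (\<forall>a. \<forall>\<^sub>F n in sequentially. g a < g (s n))"
proof -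
  \<comment> \<open>Thresholds are \<open>m - 1 / real (Suc n)\<close> below a finite supremum
    \<open>m\<close>, which is not attained, and \<open>real n\<close> if the values are
    unbounded.\<close>
  have "\<exists>t :: nat \<Rightarrow> real. (\<forall>n. \<exists>a. t n < g a) \<and> (\<forall>a. \<forall>\<^sub>F n in sequentially. g a < t n)"
  proof (cases "bdd_above (range g)")
    case True
    define m where "m = (SUP a. g a)"
    have "g a < m" for a
      using no_max[of a] cSUP_upper[OF _ True] unfolding m_def
      by (meson UNIV_I less_le_trans)
    moreover have "(\<lambda>n. m - 1 / real (Suc n)) \<longlonglongrightarrow> m"
      using tendsto_diff[OF tendsto_const[of m] lim_inverse_n'[THEN LIMSEQ_Suc]] by simp
    ultimately have "\<forall>a. \<forall>\<^sub>F n in sequentially. g a < m - 1 / real (Suc n)"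
      using order_tendstoD(1) by blast
    moreover have "\<exists>a. m - 1 / real (Suc n) < g a" for n
      using less_cSUP_iff[OF _ True, of "m - 1 / real (Suc n)"] by (simp add: m_def)
    ultimately show ?thesis by (intro exI[of _ "\<lambda>n. m - 1 / real (Suc n)"]) blast
  next
    case False
    then have "\<exists>a. real n < g a" for n
      by (auto simp: bdd_above_def not_le)
    moreover have "\<forall>\<^sub>F n in sequentially. g a < real n" for a
      using filterlim_real_sequentially by (simp add: filterlim_at_top_dense)
    ultimately show ?thesis by (intro exI[of _ real]) blast
  qed
  then obtain t :: "nat \<Rightarrow> real"
    where t: "\<And>n. \<exists>a. t n < g a" "\<And>a. \<forall>\<^sub>F n in sequentially. g a < t n"
    by blast
  have "\<exists>s. \<forall>n. t n < g (s n) \<and> g (s n) < g (s (Suc n))"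
  proof (rule dependent_nat_choice)
    fix a n
    obtain b where b: "t (Suc n) < g b" using t(1) by blast
    obtain b' where b': "g a < g b'" using no_max by blast
    show "\<exists>y. t (Suc n) < g y \<and> g a < g y"
      using b b' by (cases "g b \<le> g b'") (auto intro: less_trans less_le_trans)
  qed (use t in blast)
  then obtain s where s: "\<And>n. t n < g (s n)" "\<And>n. g (s n) < g (s (Suc n))" by blast
  have "\<forall>\<^sub>F n in sequentially. g a < g (s n)" for a
    using t(2)[of a] by eventually_elim (use s(1) less_trans in blast)
  moreover have "strict_mono (\<lambda>n. g (s n))" using s(2) by (simp add: strict_mono_Suc_iff)
  ultimately show ?thesis by blast
qed

lemma pseudo_convergent_without_center:
  fixes v :: "'k::alg_closed_field \<Rightarrow> real"
  assumes v: "valuation v" and w: "valuation w" "extends_valuation w v"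
    and no_max: "\<And>a. \<exists>b. w (lin a) < w (lin b)"
  shows "\<exists>s. inj s \<and> pseudo_convergent v (seq_order s) (\<lambda>x. x) \<and>
    limit_valuation w v (seq_order s) (\<lambda>x. x)"
proof -
  obtain s where mono: "strict_mono (\<lambda>n. w (lin (s n)))"
    and cofinal: "\<And>a. \<forall>\<^sub>F n in sequentially. w (lin a) < w (lin (s n))"
    using cofinal_sequence[of "\<lambda>a. w (lin a)"] no_max by blast
  have inj: "inj s"
    using strict_mono_eq[OF mono] by (intro injI) metis
  have "v (s j - s i) = w (lin (s i))" if "i < j" for i j
    using strict_monoD[OF mono that] by (rule valuation_lin_dominant[OF w])
  then have "pseudo_convergent v (seq_order s) (\<lambda>x. x)"
    using inj mono by (intro pseudo_convergent_seq_order)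
  \<comment> \<open>The sequence is eventually constant: once \<open>w (lin (s n))\<close> exceeds
    \<open>w (lin a)\<close>, its term equals \<open>w (lin a)\<close>.\<close>
  moreover have "(\<lambda>n. v (s n - a)) \<longlonglongrightarrow> w (lin a)" for a
    by (rule tendsto_eventually, rule eventually_mono[OF cofinal[of a]])
      (rule valuation_lin_dominant[OF w])
  ultimately show ?thesis
    using limit_valuation_seq_order[OF v w inj] inj by blast
qed

section \<open>One-units and immediate extensions\<close>

text \<open>For a valuation \<open>w\<close> with maximal ideal M this describes the subgroup of
  K(X)* generated by K* and 1 + M.\<close>

definition one_unit_multiple :: "('k::field poly fract \<Rightarrow> real) \<Rightarrow> 'k poly fract \<Rightarrow> bool" where
  "one_unit_multiple w \<phi> \<longleftrightarrow> (\<exists>c u. c \<noteq> 0 \<and> u \<in> max_ideal w \<and> \<phi> = const_fract c * (1 + u))"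

lemma one_unit_multiple_mult:
  assumes "valuation w" "one_unit_multiple w \<phi>" "one_unit_multiple w \<psi>"
  shows "one_unit_multiple w (\<phi> * \<psi>)"
proof -
  obtain c u d z where *: "c \<noteq> 0" "u \<in> max_ideal w" "\<phi> = const_fract c * (1 + u)"
      "d \<noteq> 0" "z \<in> max_ideal w" "\<psi> = const_fract d * (1 + z)"
    using assms(2,3) by (auto simp: one_unit_multiple_def)
  have "u + (z + u * z) \<in> max_ideal w"
    using * max_ideal_subset by (intro max_ideal_add max_ideal_mult assms(1)) auto
  moreover have "\<phi> * \<psi> = const_fract (c * d) * (1 + (u + (z + u * z)))"
    using * by (simp add: const_fract_mult algebra_simps)
  ultimately show ?thesis
    using * unfolding one_unit_multiple_def by (metis no_zero_divisors)
qed

lemma one_unit_multiple_inverse: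
  assumes "valuation w" "one_unit_multiple w \<phi>"
  shows "one_unit_multiple w (inverse \<phi>)"
proof -
  obtain c u where *: "c \<noteq> 0" "u \<in> max_ideal w" "\<phi> = const_fract c * (1 + u)"
    using assms(2) by (auto simp: one_unit_multiple_def)
  note unit = one_unit[OF assms(1) *(2)]
  have "inverse (1 + u) \<in> valuation_domain w"
    using unit valuation_inverse[OF assms(1)] by (simp add: valuation_domain_def)
  then have "- (inverse (1 + u) * u) \<in> max_ideal w"
    using * assms(1) by (intro max_ideal_minus max_ideal_mult)
  \<comment> \<open>The inverse of a one-unit is again one: 1/(1+u) = 1 - u/(1+u).\<close>
  moreover have "inverse (1 + u) = 1 + - (inverse (1 + u) * u)"
    using unit(1) by (simp add: field_simps)
  then have "inverse \<phi> = const_fract (inverse c) * (1 + - (inverse (1 + u) * u))"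
    using * by (metis const_fract_inverse inverse_mult_distrib)
  ultimately show ?thesis
    using * unfolding one_unit_multiple_def by (metis nonzero_imp_inverse_nonzero)
qed

text \<open>It suffices to treat X - a, as the property passes to products and inverses. For
  \<open>b\<close> with larger value, X - a = (b - a) + (X - b), where the constant
  dominates.\<close>

lemma one_unit_multiple_of_no_max:
  fixes w :: "'k::alg_closed_field poly fract \<Rightarrow> real"
  assumes w: "valuation w" "extends_valuation w v"
    and no_max: "\<And>a. \<exists>b. w (lin a) < w (lin b)" and "\<phi> \<noteq> 0"
  shows "one_unit_multiple w \<phi>"
proof -
  have lin: "one_unit_multiple w (lin a)" for a
  proof -
    obtain b where b: "w (lin a) < w (lin b)" using no_max by blast
    then have ne: "b - a \<noteq> 0" by auto
    then have "w (const_fract (b - a)) = w (lin a)"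
      using extends_valuation_const[OF w(2)] valuation_lin_dominant[OF w b] by metis
    then have "lin b / const_fract (b - a) \<in> max_ideal w"
      using b ne by (simp add: max_ideal_def valuation_divide[OF w(1)])
    moreover have "lin a = lin b + const_fract (b - a)"
      by (simp flip: lin_diff)
    then have "lin a = const_fract (b - a) * (1 + lin b / const_fract (b - a))"
      using ne by (simp add: distrib_left)
    ultimately show ?thesis
      using ne unfolding one_unit_multiple_def by blast
  qed
  have poly: "one_unit_multiple w (to_fract p)" if "p \<noteq> 0" for p
    using that
  proof (induction p rule: poly_linear_factors_induct)
    case (const c)
    then have "to_fract [:c:] = const_fract c * (1 + 0)" by (simp add: const_fract_def)
    moreover have "0 \<in> max_ideal w" by (simp add: max_ideal_def)
    ultimately show ?case using const unfolding one_unit_multiple_def by blast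
  next
    case (linear a p)
    then show ?case
      using one_unit_multiple_mult[OF w(1) lin] by (simp del: mult_pCons_left add: to_fract_mult)
  qed
  show ?thesis
  proof (cases \<phi>)
    case (Fract p q)
    then have "p \<noteq> 0" "q \<noteq> 0" using assms(4) by (auto simp: fract_collapse)
    then show ?thesis
      using one_unit_multiple_mult[OF w(1) poly one_unit_multiple_inverse[OF w(1) poly]] Fract
      by (simp add: Fract_conv_to_fract divide_inverse)
  qed
qed

text \<open>A one-unit has value 0 and residue 1, so the constant factor of a nonzero function in W
  has the same value and residue as the function.\<close>

lemma immediate_extension_of_no_max:
  fixes w :: "'k::alg_closed_field poly fract \<Rightarrow> real"
  assumes w: "valuation w" "extends_valuation w v"
    and no_max: "\<And>a. \<exists>b. w (lin a) < w (lin b)"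
  shows "immediate_extension w v"
proof -
  have const: "\<exists>c. c \<noteq> 0 \<and> w \<phi> = v c \<and>
      (0 \<le> w \<phi> \<longrightarrow> residue_class w \<phi> = residue_class w (const_fract c))" if "\<phi> \<noteq> 0" for \<phi>
  proof -
    have "one_unit_multiple w \<phi>" using w no_max that by (rule one_unit_multiple_of_no_max)
    then obtain c u where *: "c \<noteq> 0" "u \<in> max_ideal w" "\<phi> = const_fract c * (1 + u)"
      by (auto simp: one_unit_multiple_def)
    have wc: "w (const_fract c) = v c" using * extends_valuation_const[OF w(2)] by blast
    have "w \<phi> = v c"
      using * one_unit[OF w(1) *(2)] valuation_mult[OF w(1), of "const_fract c" "1 + u"] wc by simp
    moreover have "\<phi> - const_fract c \<in> max_ideal w" if "0 \<le> w \<phi>"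
    proof -
      \<comment> \<open>This product is the difference of \<phi> and the constant; the constant lies
        in W because it has the same value as \<phi>.\<close>
      have "const_fract c * u \<in> max_ideal w"
        using that * wc \<open>w \<phi> = v c\<close>
        by (intro max_ideal_mult w(1)) (auto simp: valuation_domain_def)
      then show ?thesis using * by (simp add: algebra_simps)
    qed
    ultimately show ?thesis
      using * residue_class_cong[OF w(1)] by blast
  qed
  have "value_group w \<subseteq> value_group v"
    using const by (fastforce simp: value_group_def)
  moreover have "value_group v \<subseteq> value_group w"
  proof
    fix g assume "g \<in> value_group v"
    then obtain a where "a \<noteq> 0" "g = v a" by (auto simp: value_group_def)
    then show "g \<in> value_group w"
      using extends_valuation_const[OF w(2)] by (auto simp: value_group_def
        intro!: image_eqI[of _ _ "const_fract a"])
  qed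
  moreover have "residue_class w \<phi> \<in> (\<lambda>a. residue_class w (const_fract a)) ` valuation_domain v"
    if "\<phi> \<in> valuation_domain w" for \<phi>
  proof (cases "\<phi> = 0")
    case True
    then show ?thesis
      by (intro image_eqI[of _ _ 0]) (auto simp: valuation_domain_def)
  next
    case False
    with that const[OF False] show ?thesis by (force simp: valuation_domain_def)
  qed
  moreover have "const_fract a \<in> valuation_domain w" if "a \<in> valuation_domain v" for a
    using that extends_valuation_const[OF w(2), of a]
    by (cases "a = 0") (auto simp: valuation_domain_def)
  ultimately show ?thesis
    unfolding immediate_extension_def residue_field_def by blast
qed

theorem theorem7p4:
  fixes v :: "'k::alg_closed_field \<Rightarrow> real"
    and w :: "'k poly fract \<Rightarrow> real"
  assumes "rank_one_valuation v"
    and "\<not> fin_gen_ideal (valuation_domain v) (max_ideal v)"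
    and "infinite (residue_field v)"
    and "rank_one_valuation w"
    and "extends_valuation w v"
  shows "(\<exists>(r :: 'k rel) s. index_order r \<and> pseudo_convergent v r s \<and> limit_valuation w v r s) \<and>
    (\<not> immediate_extension w v \<longrightarrow>
      (\<exists>(r :: 'k rel) t. index_order r \<and> pseudo_divergent v r t \<and> limit_valuation w v r t))"
proof -
  have v: "valuation v" and w: "valuation w"
    using assms(1,4) by (simp_all add: rank_one_valuation_def)
  show ?thesis
  \<comment> \<open>The split is whether the values of X - a attain a maximum; a point
    \<open>b\<close> where they do serves as center of both sequences.\<close>
  proof (cases "\<exists>b. \<forall>a. w (lin a) \<le> w (lin b)")
    case True
    then obtain b where b: "\<And>a. w (lin a) \<le> w (lin b)" by blast
    show ?thesis
      using pseudo_convergent_around_center[OF assms(1) w assms(5) b]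
        pseudo_divergent_around_center[OF assms(1) w assms(5) b] index_order_seq_order
      by blast
  next
    case False
    then have no_max: "\<And>a. \<exists>b. w (lin a) < w (lin b)" by (meson not_le)
    \<comment> \<open>The extension is immediate in this case, so the second claim holds
      vacuously.\<close>
    show ?thesis
      using pseudo_convergent_without_center[OF v w assms(5) no_max]
        immediate_extension_of_no_max[OF w assms(5) no_max] index_order_seq_order
      by blast
  qed
qed

end
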